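(* Let $j_1,\dots,j_n$ ($n\ge 1$) be passengers going to a common destination, ordered by nondecreasing requested arrival time, and let $\phi(n)$ be the number of partitions of these $n$ passengers into groups such that each group consists of passengers that are consecutive in this order and can travel together on a common commuter vehicle. If the time windows and requested arrival times are such that every pair of consecutive passengers $j_i,j_{i+1}$ ($1\le i\le n-1$) can travel with one another on a common commuter vehicle, then $\phi(n)$ is bounded below by the $(n+1)$st Fibonacci number, and hence is exponential in $n$: $\phi(n)=\Omega(1.6^n)$.
   Context: Each passenger $j$ going to destination $d$ has a requested arrival time $t^r(j)$ and must arrive at $d$ in the window $[t^r(j)-T_w,\,t^r(j)+T_w]$, with $T_w$ common to all passengers. A vehicle departing the terminal at time $t$ arrives at $d$ at time $t+\tau^1(d)$. A commuter vehicle can carry at most $v^{\mathrm{cap}}$ passengers. A nonempty set of passengers can travel together on a common commuter vehicle if it has at most $v^{\mathrm{cap}}$ elements and there is a single departure time from the terminal that is feasible for all of them (arrival lies in every one of their windows, and passengers can reach the terminal by mass transit no later than the departure time). Each individual passenger can travel alone. Vehicle availability (the number of vehicles in use at once) is not taken into account in the count $\phi(n)$. Fibonacci numbers are indexed by $F_1=F_2=1$, $F_{k+2}=F_{k+1}+F_k$, so the $(n+1)$st Fibonacci number is $F_{n+1}$ (values $1,2,3,5,\dots$ for $n=1,2,3,4,\dots$). The notation $\phi(n)=\Omega(1.6^n)$ means there is an absolute constant $c>0$ with $\phi(n)\ge c\cdot 1.6^n$ for all $n\ge 1$. *)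

theory Defs
  imports Complex_Main "HOL-Library.Disjoint_Sets" "HOL-Number_Theory.Fib"
begin

(* Passengers and destinations are labelled by natural numbers, rather than by elements
   of type variables, so that one constant can be asserted for all instances at once. *)
type_synonym passenger = nat
type_synonym destination = nat

(* transit_arrivals p: the times at which mass transit can bring p to the terminal. *)
record commuter_instance =
  half_window :: real
  capacity :: nat
  travel_time :: "destination \<Rightarrow> real"
  destination_of :: "passenger \<Rightarrow> destination"
  requested_arrival :: "passenger \<Rightarrow> real"
  transit_arrivals :: "passenger \<Rightarrow> real set"

definition feasible_departure ::
  "commuter_instance \<Rightarrow> destination \<Rightarrow> real \<Rightarrow> passenger \<Rightarrow> bool" where
  "feasible_departure I d t p \<longleftrightarrow>
     destination_of I p = d \<and>
     t + travel_time I d \<in> {requested_arrival I p - half_window I ..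
                              requested_arrival I p + half_window I} \<and>
     (\<exists>s \<in> transit_arrivals I p. s \<le> t)"

definition can_travel_together :: "commuter_instance \<Rightarrow> passenger set \<Rightarrow> bool" where
  "can_travel_together I G \<longleftrightarrow>
     G \<noteq> {} \<and> finite G \<and> card G \<le> capacity I \<and>
     (\<exists>d t. \<forall>p \<in> G. feasible_departure I d t p)"

(* The sequence j 1, ..., j n; values of j outside {1..n} are irrelevant. *)
definition passenger_sequence ::
  "commuter_instance \<Rightarrow> destination \<Rightarrow> nat \<Rightarrow> (nat \<Rightarrow> passenger) \<Rightarrow> bool" where
  "passenger_sequence I d n j \<longleftrightarrow>
     inj_on j {1..n} \<and>
     (\<forall>i \<in> {1..n}. destination_of I (j i) = d) \<and>
     mono_on {1..n} (\<lambda>i. requested_arrival I (j i)) \<and>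
     (\<forall>i \<in> {1..n}. can_travel_together I {j i})"

definition consecutive_group :: "nat \<Rightarrow> (nat \<Rightarrow> passenger) \<Rightarrow> passenger set \<Rightarrow> bool" where
  "consecutive_group n j G \<longleftrightarrow> (\<exists>a b. 1 \<le> a \<and> a \<le> b \<and> b \<le> n \<and> G = j ` {a..b})"

definition num_partitions :: "commuter_instance \<Rightarrow> nat \<Rightarrow> (nat \<Rightarrow> passenger) \<Rightarrow> nat" where
  "num_partitions I n j =
     card {P. partition_on (j ` {1..n}) P \<and>
              (\<forall>G \<in> P. consecutive_group n j G \<and> can_travel_together I G)}"

definition consecutive_pairs_can_travel ::
  "commuter_instance \<Rightarrow> nat \<Rightarrow> (nat \<Rightarrow> passenger) \<Rightarrow> bool" where
  "consecutive_pairs_can_travel I n j \<longleftrightarrow>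
     (\<forall>i. 1 \<le> i \<and> i + 1 \<le> n \<longrightarrow> can_travel_together I {j i, j (i + 1)})"

end

theory Submission
  imports Defs
begin

text \<open>
  A partition of the first \<open>n + 1\<close> passengers extends to the first \<open>n + 2\<close> by letting the last
  passenger travel alone, and a partition of the first \<open>n\<close> by letting the last two travel
  together. The two families of extensions are disjoint, since they differ in whether the last
  passenger is alone; hence \<open>\<phi>(n + 2) \<ge> \<phi>(n + 1) + \<phi>(n)\<close>, the Fibonacci recurrence.
  The exponential bound holds because \<open>1.6\<^sup>2 \<le> 1.6 + 1\<close>.
\<close>

definition travel_partitions ::
  "commuter_instance \<Rightarrow> nat \<Rightarrow> (nat \<Rightarrow> passenger) \<Rightarrow> passenger set set set" where
  "travel_partitions I n j =
     {P. partition_on (j ` {1..n}) P \<and>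
         (\<forall>G \<in> P. consecutive_group n j G \<and> can_travel_together I G)}"

lemma num_partitions_eq_card: "num_partitions I n j = card (travel_partitions I n j)"
  by (simp add: num_partitions_def travel_partitions_def)

lemma finite_travel_partitions: "finite (travel_partitions I n j)"
proof (rule finite_subset)
  show "travel_partitions I n j \<subseteq> {P. partition_on (j ` {1..n}) P}"
    by (auto simp: travel_partitions_def)
qed (simp add: finitely_many_partition_on)

text \<open>The empty set has exactly one partition, the empty one. This makes the count 1 at
  \<open>n = 0\<close>, matching \<open>fib 1\<close>, so the induction can start there.\<close>

lemma travel_partitions_0: "travel_partitions I 0 j = {{}}"
  by (auto simp: travel_partitions_def partition_on_empty)

lemma consecutive_group_mono:
  "consecutive_group m j G \<Longrightarrow> m \<le> n \<Longrightarrow> consecutive_group n j G"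
  unfolding consecutive_group_def using le_trans by blast

text \<open>A nonempty \<open>X\<close> disjoint from \<open>A\<close> is never a block of a
  partition of \<open>A\<close>, so removing \<open>X\<close> from \<open>insert X P\<close>
  recovers \<open>P\<close>.\<close>

lemma inj_on_insert_partition:
  assumes "X \<noteq> {}" "disjnt X A" "\<And>P. P \<in> \<P> \<Longrightarrow> partition_on A P"
  shows "inj_on (insert X) \<P>"
proof -
  have "X \<notin> P" if "P \<in> \<P>" for P
  proof
    assume "X \<in> P"
    then have "X \<subseteq> A"
      using assms(3)[OF that] by (auto simp: partition_on_def)
    then show False
      using assms(1,2) by (auto simp: disjnt_def)
  qed
  then show ?thesis
    by (intro inj_onI) (metis insert_ident)
qed

lemma disjnt_last_group:
  fixes m n :: nat
  assumes "m < n" "inj_on j {1..n}"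
  shows "disjnt (j ` {m<..n}) (j ` {1..m})"
proof -
  have "j ` ({m<..n} \<inter> {1..m}) = j ` {m<..n} \<inter> j ` {1..m}"
    using assms(1) by (intro inj_on_image_Int[OF assms(2)]) auto
  moreover have "{m<..n} \<inter> {1..m} = {}"
    by auto
  ultimately show ?thesis
    by (simp add: disjnt_def)
qed

text \<open>The extension step for a last group of any size; the recurrence uses it with
  \<open>n - m\<close> equal to 1 and 2. Blocks of \<open>P\<close> stay consecutive because only
  the upper bound on the indices grows.\<close>

lemma insert_last_group:
  assumes P: "P \<in> travel_partitions I m j"
    and "m < n" "inj_on j {1..n}" "can_travel_together I (j ` {m<..n})"
  shows "insert (j ` {m<..n}) P \<in> travel_partitions I n j"
proof -
  have split: "{1..n} = {m<..n} \<union> {1..m}"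
    using \<open>m < n\<close> by auto
  have "disjnt (j ` {m<..n}) (j ` {1..m})"
    using assms(2,3) by (rule disjnt_last_group)
  then have "partition_on (j ` {1..n}) (insert (j ` {m<..n}) P)"
    using P \<open>m < n\<close> unfolding split travel_partitions_def image_Un
    by (subst partition_on_insert) (auto simp: partition_on_def disjnt_def)
  moreover have "consecutive_group n j (j ` {m<..n})"
    unfolding consecutive_group_def using \<open>m < n\<close>
    by (intro exI[of _ "Suc m"] exI[of _ n]) (simp add: atLeastSucAtMost_greaterThanAtMost)
  ultimately show ?thesis
    using assms consecutive_group_mono[of m j _ n] by (auto simp: travel_partitions_def)
qed

lemma card_insert_last_group:
  assumes "m < n" "inj_on j {1..n}"
  shows "card (insert (j ` {m<..n}) ` travel_partitions I m j) = card (travel_partitions I m j)"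
proof (intro card_image inj_on_insert_partition)
  show "disjnt (j ` {m<..n}) (j ` {1..m})"
    using assms by (rule disjnt_last_group)
qed (use assms in \<open>auto simp: travel_partitions_def\<close>)

text \<open>Serves the base case \<open>n = 1\<close> of the induction, where the last passenger
  alone is the only extension used.\<close>

lemma num_partitions_mono_Suc:
  assumes "inj_on j {1..Suc n}" "can_travel_together I {j (Suc n)}"
  shows "num_partitions I n j \<le> num_partitions I (Suc n) j"
proof -
  have "{n<..Suc n} = {Suc n}"
    by auto
  then have "insert {j (Suc n)} ` travel_partitions I n j \<subseteq> travel_partitions I (Suc n) j"
    using insert_last_group[of _ I n j "Suc n"] assms by auto
  from card_mono[OF finite_travel_partitions this] show ?thesis
    using card_insert_last_group[of n "Suc n" j I] assms \<open>{n<..Suc n} = {Suc n}\<close>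
    by (simp add: num_partitions_eq_card)
qed

text \<open>Only an inequality, since three or more passengers at the end may also be able to share
  a vehicle.\<close>

lemma num_partitions_rec:
  assumes inj: "inj_on j {1..n + 2}"
    and one: "can_travel_together I {j (n + 2)}"
    and two: "can_travel_together I {j (n + 1), j (n + 2)}"
  shows "num_partitions I (n + 1) j + num_partitions I n j \<le> num_partitions I (n + 2) j"
proof -
  let ?S = "{j (n + 2)}" and ?D = "{j (n + 1), j (n + 2)}"
  let ?A = "insert ?S ` travel_partitions I (n + 1) j"
  let ?B = "insert ?D ` travel_partitions I n j"
  have S: "j ` {n + 1<..n + 2} = ?S"
    by (auto simp: le_Suc_eq)
  have "{n<..n + 2} = {n + 1, n + 2}"
    by auto
  then have D: "j ` {n<..n + 2} = ?D"
    by simp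
  have A: "?A \<subseteq> travel_partitions I (n + 2) j"
    using insert_last_group[of _ I "n + 1" j "n + 2"] inj one unfolding S by auto
  have B: "?B \<subseteq> travel_partitions I (n + 2) j"
    using insert_last_group[of _ I n j "n + 2"] inj two unfolding D by auto
  have "j (n + 1) \<noteq> j (n + 2)"
    using inj by (simp add: inj_on_eq_iff)
  \<comment> \<open>A common element would have both \<open>?S\<close> and \<open>?D\<close> as
    blocks. They share \<open>j (n + 2)\<close>, so they would coincide, against the injectivity of
    \<open>j\<close>.\<close>
  have "?A \<inter> ?B = {}"
  proof (rule ccontr)
    assume "?A \<inter> ?B \<noteq> {}"
    then obtain P where P: "P \<in> ?A" "P \<in> ?B"
      by (meson disjoint_iff)
    then have "?S \<in> P" "?D \<in> P"
      by (metis imageE insertI1)+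
    moreover have "partition_on (j ` {1..n + 2}) P"
      using A P(1) by (auto simp: travel_partitions_def)
    ultimately have "disjnt ?S ?D \<or> ?S = ?D"
      unfolding partition_on_def pairwise_def by metis
    then have "?S = ?D"
      by (simp add: disjnt_def)
    with \<open>j (n + 1) \<noteq> j (n + 2)\<close> show False
      by auto
  qed
  then have "card ?A + card ?B = card (?A \<union> ?B)"
    by (simp add: card_Un_disjoint finite_travel_partitions)
  also have "\<dots> \<le> card (travel_partitions I (n + 2) j)"
    using A B by (intro card_mono finite_travel_partitions) auto
  finally show ?thesis
    using card_insert_last_group[of "n + 1" "n + 2" j I] card_insert_last_group[of n "n + 2" j I] inj
    unfolding S D by (simp add: num_partitions_eq_card)
qed

lemma fib_le_num_partitions:
  assumes "inj_on j {1..n}"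
    and "\<And>i. i \<in> {1..n} \<Longrightarrow> can_travel_together I {j i}"
    and "consecutive_pairs_can_travel I n j"
  shows "fib (n + 1) \<le> num_partitions I n j"
  using assms
\<comment> \<open>The recurrence reaches back two steps, hence base cases 0 and 1. All three
  assumptions pass to shorter initial segments of the sequence.\<close>
proof (induction n rule: fib.induct)
  case 1
  then show ?case
    by (simp add: num_partitions_eq_card travel_partitions_0)
next
  case 2
  then show ?case
    using num_partitions_mono_Suc[of j 0 I]
    by (simp add: num_partitions_eq_card travel_partitions_0)
next
  case (3 n)
  have inj: "inj_on j {1..m}" if "m \<le> n + 2" for m
    using that by (intro inj_on_subset[OF "3.prems"(1)]) auto
  have pairs: "consecutive_pairs_can_travel I m j" if "m \<le> n + 2" for m
    using "3.prems"(3) that by (simp add: consecutive_pairs_can_travel_def)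
  have "fib (n + 1) \<le> num_partitions I n j"
    using inj pairs "3.prems"(2) by (intro "3.IH"(2)) auto
  moreover have "fib (n + 2) \<le> num_partitions I (n + 1) j"
    using inj[of "Suc n"] pairs[of "Suc n"] "3.IH"(1) "3.prems"(2) by auto
  moreover have "can_travel_together I {j (n + 1), j (n + 2)}"
    using "3.prems"(3) by (auto simp: consecutive_pairs_can_travel_def dest: spec[of _ "n + 1"])
  then have "num_partitions I (n + 1) j + num_partitions I n j \<le> num_partitions I (n + 2) j"
    using inj[of "n + 2"] "3.prems"(2) by (intro num_partitions_rec) auto
  ultimately show ?case
    by simp
qed

text \<open>The factor \<open>5 / 8\<close> is \<open>1 / 1.6\<close>, the largest possible:
  equality holds at \<open>n = 1\<close>.\<close>

lemma fib_exponential_lower_bound: "5 / 8 * 1.6 ^ n \<le> real (fib (n + 1))"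
proof (induction n rule: fib.induct)
  case (3 n)
  \<comment> \<open>After division by \<open>5 / 8 * 1.6 ^ n\<close> this is
    \<open>2.56 \<le> 2.6\<close>.\<close>
  have "5 / 8 * (1.6::real) ^ (n + 2) \<le> 5 / 8 * 1.6 ^ Suc n + 5 / 8 * 1.6 ^ n"
    by simp
  with 3 show ?case
    by simp
qed simp_all

theorem theorem3:
  "(\<forall>I d n j. n \<ge> 1 \<and> passenger_sequence I d n j \<and> consecutive_pairs_can_travel I n j
       \<longrightarrow> fib (n + 1) \<le> num_partitions I n j)
   \<and> (\<exists>c::real. c > 0 \<and>
       (\<forall>I d n j. n \<ge> 1 \<and> passenger_sequence I d n j \<and> consecutive_pairs_can_travel I n j
          \<longrightarrow> c * (1.6::real) ^ n \<le> real (num_partitions I n j)))"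
proof -
  have fib: "fib (n + 1) \<le> num_partitions I n j"
    if "passenger_sequence I d n j" "consecutive_pairs_can_travel I n j" for I d n j
    using that by (intro fib_le_num_partitions) (auto simp: passenger_sequence_def)
  moreover have "5 / 8 * 1.6 ^ n \<le> real (num_partitions I n j)"
    if "passenger_sequence I d n j" "consecutive_pairs_can_travel I n j" for I d n j
    using fib_exponential_lower_bound[of n] fib[OF that] by linarith
  ultimately show ?thesis
    by (intro conjI exI[of _ "5 / 8"]) auto
qed

end
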